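(* Let $\mathfrak{g}$ be a finite-dimensional complex Lie algebra and let $D$ be a multiplicative Hom-Lie algebra structure on $\mathfrak{g}$. (1) If $D$ is nilpotent, then there exists a polynomial $f(t)\in\mathbb{Z}[t]$ such that $$\mathcal{H}(\mathrm{Der}_D(\mathfrak{g}),t)=\frac{f(t)}{1-t}.$$ (2) If $D^m=D$ for some integer $m\ge 2$, then there exists a polynomial $f(t)\in\mathbb{Z}[t]$ such that $$\mathcal{H}(\mathrm{Der}_D(\mathfrak{g}),t)=\frac{f(t)}{1-t^{m-1}}.$$
   Context: A linear map $D:\mathfrak{g}\to\mathfrak{g}$ is a Hom-Lie algebra structure on $\mathfrak{g}$ if $[D(x),[y,z]]+[D(y),[z,x]]+[D(z),[x,y]]=0$ for all $x,y,z\in\mathfrak{g}$; it is multiplicative if moreover $D([x,y])=[D(x),D(y)]$ for all $x,y\in\mathfrak{g}$. For $k\in\mathbb{N}=\{0,1,2,\dots\}$, $D^k$ is the $k$-fold composite of $D$ ($D^0$ the identity). $\mathrm{Der}_k(\mathfrak{g})$ is the space of $D^k$-derivations, i.e. linear maps $\delta:\mathfrak{g}\to\mathfrak{g}$ with $D\circ\delta=\delta\circ D$ and $\delta([x,y])=[\delta(x),D^k(y)]+[D^k(x),\delta(y)]$ for all $x,y\in\mathfrak{g}$. The derivation algebra is the (external) direct sum $\mathrm{Der}_D(\mathfrak{g})=\bigoplus_{k=0}^\infty\mathrm{Der}_k(\mathfrak{g})$, and its Hilbert series is $\mathcal{H}(\mathrm{Der}_D(\mathfrak{g}),t)=\sum_{k=0}^\infty\dim_{\mathbb{C}}(\mathrm{Der}_k(\mathfrak{g}))\,t^k$,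 a formal power series in $t$ (with $t$ real, convergence assumes $|t|<1$, respectively $|t^{m-1}|<1$ in part (2)). *)

theory Defs
  imports
    Complex_Main
    "HOL-Library.Function_Algebras"
    "HOL-Computational_Algebra.Polynomial_FPS"
begin

locale lie_algebra = vector_space scale
  for scale :: "'k::field \<Rightarrow> 'a::ab_group_add \<Rightarrow> 'a" +
  fixes bracket :: "'a \<Rightarrow> 'a \<Rightarrow> 'a"
  assumes linear_bracket_left: "Vector_Spaces.linear scale scale (\<lambda>x. bracket x y)"
    and linear_bracket_right: "Vector_Spaces.linear scale scale (\<lambda>y. bracket x y)"
    and bracket_self: "bracket x x = 0"
    and jacobi: "bracket x (bracket y z) + bracket y (bracket z x) + bracket z (bracket x y) = 0"

definition hom_lie_structure ::
    "('k::field \<Rightarrow> 'a::ab_group_add \<Rightarrow> 'a) \<Rightarrow> ('a \<Rightarrow> 'a \<Rightarrow> 'a) \<Rightarrow> ('a \<Rightarrow> 'a) \<Rightarrow> bool"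
  where "hom_lie_structure scale bracket D \<longleftrightarrow>
    Vector_Spaces.linear scale scale D \<and>
    (\<forall>x y z. bracket (D x) (bracket y z) + bracket (D y) (bracket z x)
              + bracket (D z) (bracket x y) = 0)"

definition multiplicative_hom_lie_structure ::
    "('k::field \<Rightarrow> 'a::ab_group_add \<Rightarrow> 'a) \<Rightarrow> ('a \<Rightarrow> 'a \<Rightarrow> 'a) \<Rightarrow> ('a \<Rightarrow> 'a) \<Rightarrow> bool"
  where "multiplicative_hom_lie_structure scale bracket D \<longleftrightarrow>
    hom_lie_structure scale bracket D \<and>
    (\<forall>x y. D (bracket x y) = bracket (D x) (D y))"

definition nilpotent_map :: "('a::zero \<Rightarrow> 'a) \<Rightarrow> bool"
  where "nilpotent_map D \<longleftrightarrow> (\<exists>n. D ^^ n = (\<lambda>x. 0))"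

definition Der ::
    "('k::field \<Rightarrow> 'a::ab_group_add \<Rightarrow> 'a) \<Rightarrow> ('a \<Rightarrow> 'a \<Rightarrow> 'a) \<Rightarrow> ('a \<Rightarrow> 'a) \<Rightarrow> nat
      \<Rightarrow> ('a \<Rightarrow> 'a) set"
  where "Der scale bracket D k =
    {\<delta>. Vector_Spaces.linear scale scale \<delta> \<and> D \<circ> \<delta> = \<delta> \<circ> D \<and>
        (\<forall>x y. \<delta> (bracket x y) =
                 bracket (\<delta> x) ((D ^^ k) y) + bracket ((D ^^ k) x) (\<delta> y))}"

definition fun_scale :: "('k \<Rightarrow> 'b \<Rightarrow> 'b) \<Rightarrow> 'k \<Rightarrow> ('a \<Rightarrow> 'b) \<Rightarrow> 'a \<Rightarrow> 'b"
  where "fun_scale scale c f = (\<lambda>x. scale c (f x))"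

lemma vector_space_fun_scale:
  assumes "vector_space scale"
  shows "vector_space (fun_scale scale)"
proof -
  interpret vector_space scale by fact
  show ?thesis
    by unfold_locales (simp_all add: fun_scale_def fun_eq_iff algebra_simps)
qed

text \<open>The set \<open>Der scale bracket D k\<close> is a subspace of the space of all functions with
  the pointwise operations, so \<open>vector_space.dim (fun_scale scale)\<close> is its dimension.\<close>

lemma subspace_Der:
  assumes "lie_algebra scale bracket" and "Vector_Spaces.linear scale scale D"
  shows "module.subspace (fun_scale scale) (Der scale bracket D k)"
proof -
  interpret lie_algebra scale bracket by fact
  interpret F: vector_space "fun_scale scale"
    by (rule vector_space_fun_scale) (rule vector_space_axioms)
  interpret D: Vector_Spaces.linear scale scale D by fact
  interpret P: vector_space_pair scale scale ..
  interpret L: Vector_Spaces.linear scale scale "\<lambda>x. bracket x y" for y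
    by (rule linear_bracket_left)
  interpret R: Vector_Spaces.linear scale scale "\<lambda>y. bracket x y" for x
    by (rule linear_bracket_right)
  show ?thesis
  proof (rule F.subspaceI)
    show "0 \<in> Der scale bracket D k"
      using P.linear_0
      by (auto simp: Der_def zero_fun_def fun_eq_iff D.zero L.zero R.zero
          intro: P.module_hom_zero)
  next
    fix f g assume "f \<in> Der scale bracket D k" "g \<in> Der scale bracket D k"
    then show "f + g \<in> Der scale bracket D k"
      using P.linear_compose_add[of f g]
      by (auto simp: Der_def plus_fun_def fun_eq_iff D.add L.add R.add)
  next
    fix c f assume "f \<in> Der scale bracket D k"
    then show "fun_scale scale c f \<in> Der scale bracket D k"
      using P.linear_compose_scale_right[of f c]
      by (auto simp: Der_def fun_scale_def fun_eq_iff D.scale L.scale R.scale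
          scale_right_distrib)
  qed
qed

text \<open>The external direct sum of the spaces \<open>Der scale bracket D k\<close> is represented by the
  family of its homogeneous components, which is all the Hilbert series depends on. The
  coefficients are natural numbers; they are placed in \<open>real\<close> so that division by
  a power series with constant term \<open>1\<close> is available.\<close>

definition hilbert_series ::
    "('k::field \<Rightarrow> 'b::ab_group_add \<Rightarrow> 'b) \<Rightarrow> (nat \<Rightarrow> 'b set) \<Rightarrow> real fps"
  where "hilbert_series scale V = Abs_fps (\<lambda>k. real (vector_space.dim scale (V k)))"

abbreviation hilbert_series_Der ::
    "('k::field \<Rightarrow> 'a::ab_group_add \<Rightarrow> 'a) \<Rightarrow> ('a \<Rightarrow> 'a \<Rightarrow> 'a) \<Rightarrow> ('a \<Rightarrow> 'a) \<Rightarrow> real fps"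
  where "hilbert_series_Der scale bracket D \<equiv>
    hilbert_series (fun_scale scale) (Der scale bracket D)"

end

theory Submission
  imports Defs
begin

text \<open>The spaces of \<open>D\<^sup>k\<close>-derivations depend on \<open>k\<close> only through the map \<open>D ^^ k\<close>. In both
  parts the powers of \<open>D\<close> are ultimately periodic: with period \<open>1\<close> once they vanish if \<open>D\<close> is
  nilpotent, and with period \<open>m - 1\<close> from the exponent \<open>1\<close> on if \<open>D ^^ m = D\<close>. Hence the
  dimensions form an ultimately periodic sequence of natural numbers, with some period \<open>p\<close>.
  Multiplying its generating function by \<open>1 - X\<^sup>p\<close> subtracts from the sequence its shift by \<open>p\<close>,
  which leaves finitely many nonzero coefficients, all integers
  (\<open>fps_eventually_periodic_rational\<close>). The denominator has constant term \<open>1\<close>, so it can be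
  divided out again.\<close>

text \<open>The polynomial is \<open>(1 - X\<^sup>p) \<cdot> \<Sum> a\<^sub>k X\<^sup>k\<close>: its \<open>k\<close>-th coefficient is \<open>a\<^sub>k - a\<^sub>k\<^sub>-\<^sub>p\<close>
  (or \<open>a\<^sub>k\<close> for \<open>k < p\<close>), which vanishes for \<open>k \<ge> N + p\<close>.\<close>

lemma fps_eventually_periodic_rational:
  fixes a :: "nat \<Rightarrow> nat"
  assumes p: "p > 0" and periodic: "\<And>k. k \<ge> N \<Longrightarrow> a (k + p) = a k"
  shows "\<exists>f :: int poly. Abs_fps (\<lambda>k. real (a k)) =
           fps_of_poly (map_poly real_of_int f) / (1 - fps_X ^ p)"
proof -
  let ?A = "Abs_fps (\<lambda>k. real (a k))"
  let ?q = "1 - fps_X ^ p :: real fps"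
  define c where "c k = int (a k) - (if k < p then 0 else int (a (k - p)))" for k
  define f where "f = Abs_poly c"
  have "c k = 0" if "k > N + p" for k
    using that periodic[of "k - p"] by (simp add: c_def)
  then have coeff_f: "coeff f = c"
    unfolding f_def by (intro coeff_Abs_poly) auto
  then have f: "fps_of_poly (map_poly real_of_int f) = ?A * ?q"
    by (auto simp: fps_eq_iff coeff_f coeff_map_poly c_def algebra_simps fps_X_power_mult_nth)
  have "fps_nth ?q 0 \<noteq> 0"
    using p by (simp add: fps_X_power_nth)
  then have "?q \<noteq> 0" by (metis fps_zero_nth)
  then have "?A = fps_of_poly (map_poly real_of_int f) / ?q"
    by (simp add: f)
  then show ?thesis by blast
qed

lemma hilbert_series_Der_eventually_periodic:
  assumes "p > 0" and powers: "D ^^ (N + p) = D ^^ N"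
  shows "\<exists>f :: int poly. hilbert_series_Der scale bracket D =
           fps_of_poly (map_poly real_of_int f) / (1 - fps_X ^ p)"
  unfolding hilbert_series_def
proof (rule fps_eventually_periodic_rational[OF \<open>p > 0\<close>])
  fix k assume "k \<ge> N"
  then obtain j where k: "k = j + N"
    using le_Suc_ex by (metis add.commute)
  have "D ^^ (k + p) = D ^^ j \<circ> D ^^ (N + p)"
    by (simp only: k funpow_add[symmetric] add.assoc)
  also have "\<dots> = D ^^ k"
    unfolding powers by (simp only: k funpow_add)
  finally show "vector_space.dim (fun_scale scale) (Der scale bracket D (k + p)) =
      vector_space.dim (fun_scale scale) (Der scale bracket D k)"
    by (simp add: Der_def)
qed

theorem theorem5p5:
  fixes scale :: "complex \<Rightarrow> 'a::ab_group_add \<Rightarrow> 'a"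
    and bracket :: "'a \<Rightarrow> 'a \<Rightarrow> 'a"
    and Basis :: "'a set"
    and D :: "'a \<Rightarrow> 'a"
  assumes "lie_algebra scale bracket"
    and "finite_dimensional_vector_space scale Basis"
    and "multiplicative_hom_lie_structure scale bracket D"
  shows "(nilpotent_map D \<longrightarrow>
           (\<exists>f :: int poly. hilbert_series_Der scale bracket D =
              fps_of_poly (map_poly real_of_int f) / (1 - fps_X)))
       \<and> (\<forall>m :: nat. m \<ge> 2 \<and> D ^^ m = D \<longrightarrow>
           (\<exists>f :: int poly. hilbert_series_Der scale bracket D =
              fps_of_poly (map_poly real_of_int f) / (1 - fps_X ^ (m - 1))))"
proof (intro conjI impI allI)
  assume "nilpotent_map D"
  then obtain n where n: "D ^^ n = (\<lambda>x. 0)"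
    by (auto simp: nilpotent_map_def)
  \<comment> \<open>Composing on the right keeps the zero map zero.\<close>
  have "D ^^ (n + 1) = D ^^ n"
    by (simp only: funpow_add n) (simp add: comp_def)
  from hilbert_series_Der_eventually_periodic[OF _ this]
  show "\<exists>f :: int poly. hilbert_series_Der scale bracket D =
      fps_of_poly (map_poly real_of_int f) / (1 - fps_X)"
    by simp
next
  fix m :: nat
  assume m: "m \<ge> 2 \<and> D ^^ m = D"
  \<comment> \<open>The periodicity starts at exponent \<open>1\<close>: unless \<open>D\<close> is invertible, \<open>D ^^ (m - 1)\<close> is not
    the identity.\<close>
  have "D ^^ (1 + (m - 1)) = D ^^ 1"
    using m by simp
  then show "\<exists>f :: int poly. hilbert_series_Der scale bracket D =
      fps_of_poly (map_poly real_of_int f) / (1 - fps_X ^ (m - 1))"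
    using m by (intro hilbert_series_Der_eventually_periodic[where N = 1]) auto
qed

end
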